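(* Let $x$ be a rational number, and let $[x]_q$ be its $q$-deformation (the $q$-rational associated to $x$), a rational function of $q$. Let $f$ be Thomae's function, $$f(x)=\begin{cases}\dfrac1b & \text{if } x=\dfrac ab \text{ with } a\in\mathbb{Z},\ b\in\mathbb{Z}_{>0},\ \gcd(a,b)=1,\\[2mm] 0 & \text{if } x\notin\mathbb{Q}.\end{cases}$$ Then the first derivative of $[x]_q$ with respect to $q$ at $q=1$ is $$\frac{d}{dq}[x]_q\Big|_{q=1}=\frac12\left(x^2-x+1-f(x)^2\right).$$
   Context: Definition of the $q$-rationals. For an integer $n$, the $q$-integer is $[n]_q=\frac{1-q^n}{1-q}$ (so $[n]_q=1+q+\cdots+q^{n-1}$ for $n\ge 1$, $[0]_q=0$, and $[n]_q$ is a Laurent polynomial in $q$ for $n<0$), with value $n$ at $q=1$; $[n]_{1/q}$ denotes the result of replacing $q$ by $1/q$ in $[n]_q$. For a rational number $x$ with finite regular continued fraction expansion $$x=a_0+\cfrac{1}{a_1+\cfrac{1}{a_2+\cfrac{1}{\ddots+\cfrac{1}{a_m}}}},\qquad a_0\in\mathbb{Z},\ a_1,\dots,a_m\in\mathbb{Z}_{\ge1},$$ its $q$-deformation is the rational function $$[x]_q=[a_0]_q+\cfrac{q^{a_0}}{[a_1]_{1/q}+\cfrac{q^{-a_1}}{[a_2]_q+\cfrac{q^{a_2}}{[a_3]_{1/q}+\cfrac{q^{-a_3}}{\ddots}}}}$$ where the terms at even index $i$ are $[a_i]_q$ (followed by numerator $q^{a_i}$), the terms at odd index $i$ are $[a_i]_{1/q}$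 (followed by numerator $q^{-a_i}$), and the expression terminates with $[a_m]_q$ if $m$ is even and $[a_m]_{1/q}$ if $m$ is odd. The result does not depend on which of the two finite continued fraction expansions of $x$ is used, and $[x]_q$ takes the value $x$ at $q=1$. *)

theory Defs
  imports
    "HOL-Computational_Algebra.Computational_Algebra"
    "HOL-Computational_Algebra.Field_as_Ring"
begin

text \<open>
  Finite regular continued fractions \<open>a\<^sub>0 + 1/(a\<^sub>1 + \<dots>)\<close>; the list holds \<open>a\<^sub>1, \<dots>, a\<^sub>m\<close>.
\<close>

fun cfrac :: "int \<Rightarrow> int list \<Rightarrow> rat" where
  "cfrac a [] = of_int a"
| "cfrac a (b # bs) = of_int a + 1 / cfrac b bs"

definition is_cfrac_of :: "rat \<Rightarrow> int \<Rightarrow> int list \<Rightarrow> bool" where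
  "is_cfrac_of x a as \<longleftrightarrow> (\<forall>b\<in>set as. b \<ge> 1) \<and> x = cfrac a as"

text \<open>
  The field element \<open>q\<close> below is only ever an indeterminate (or its inverse), so
  \<open>1 - q \<noteq> 0\<close>.
\<close>

definition q_int :: "'a::field \<Rightarrow> int \<Rightarrow> 'a" where
  "q_int q n = (1 - q powi n) / (1 - q)"

text \<open>
  Passing to the tail replaces \<open>q\<close> by \<open>1/q\<close>, which gives the alternation between
  \<open>[a\<^sub>i]\<^sub>q\<close>, \<open>q\<close> to the power \<open>a\<^sub>i\<close> (even \<open>i\<close>) and \<open>[a\<^sub>i]\<close> at \<open>1/q\<close>, \<open>q\<close> to the power
  \<open>-a\<^sub>i\<close> (odd \<open>i\<close>).
\<close>

fun q_cfrac :: "'a::field \<Rightarrow> int \<Rightarrow> int list \<Rightarrow> 'a" where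
  "q_cfrac q a [] = q_int q a"
| "q_cfrac q a (b # bs) = q_int q a + q powi a / q_cfrac (1 / q) b bs"

type_synonym ratfun = "real poly fract"

definition q_var :: ratfun where
  "q_var = to_fract [:0, 1:]"

definition q_rational :: "rat \<Rightarrow> ratfun" where
  "q_rational x = (THE r. \<exists>a as. is_cfrac_of x a as \<and> r = q_cfrac q_var a as)"

text \<open>
  Evaluation uses numerator and denominator in lowest terms, so the junk value
  \<open>z / 0 = 0\<close> occurs only at genuine poles.
\<close>

definition ratfun_eval :: "ratfun \<Rightarrow> real \<Rightarrow> real" where
  "ratfun_eval r t = (case quot_of_fract r of (n, d) \<Rightarrow> poly n t / poly d t)"

definition thomae :: "real \<Rightarrow> real" where
  "thomae x = (if x \<in> \<rat>
     then 1 / of_int (THE b. b > 0 \<and> (\<exists>a::int. coprime a b \<and> x = of_int a / of_int b))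
     else 0)"

subsection \<open>The \<open>q\<close>-deformation is well defined\<close>

lemma q_var_nontrivial: "q_var \<noteq> 0" "q_var \<noteq> 1"
  by (simp_all add: q_var_def to_fract_def One_fract_def Zero_fract_def eq_fract one_pCons)

lemma cfrac_ge: "\<forall>b\<in>set as. b \<ge> 1 \<Longrightarrow> cfrac a as \<ge> of_int a \<and> (as \<noteq> [] \<longrightarrow> cfrac a as > of_int a)"
proof (induction as arbitrary: a)
  case (Cons b bs)
  have "cfrac b bs \<ge> of_int b" "(of_int b :: rat) \<ge> 1" using Cons by auto
  then have "cfrac b bs > 0" by linarith
  then show ?case by simp
qed simp

lemma cfrac_tail_ge_1:
  assumes "\<forall>c\<in>set (b # bs). c \<ge> 1"
  shows "cfrac b bs \<ge> 1" "cfrac b bs = 1 \<Longrightarrow> b = 1 \<and> bs = []"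
proof -
  have 1: "(of_int b :: rat) \<ge> 1" using assms by simp
  have 2: "cfrac b bs \<ge> of_int b" "bs \<noteq> [] \<longrightarrow> cfrac b bs > of_int b"
    using cfrac_ge[of bs b] assms by auto
  show "cfrac b bs \<ge> 1" using 1 2 by linarith
  show "b = 1 \<and> bs = []" if "cfrac b bs = 1"
  proof -
    have "bs = []" using 1 2 that by (metis leD)
    then show ?thesis using that by simp
  qed
qed

lemma q_cfrac_integer:
  assumes "q \<noteq> 0" "q \<noteq> 1"
  shows "q_cfrac q (a - 1) [1] = q_cfrac q a []"
proof -
  have "1 - 1 / q \<noteq> 0" using assms by simp
  then have one: "q_int (1 / q) 1 = 1" by (simp add: q_int_def)
  have "q powi a = q powi (a - 1) * q" using assms by (simp add: power_int_diff)
  then have "q_int q a = q_int q (a - 1) + q powi (a - 1)"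
    unfolding q_int_def using assms(2) by (simp only:) (simp add: divide_simps, simp add: algebra_simps)
  then show ?thesis by (simp add: one)
qed

lemma int_eq_int_plus_inverse:
  fixes y :: rat
  assumes "of_int a = of_int b + 1 / y" "y \<ge> 1"
  shows "b = a - 1" "y = 1"
proof -
  have "1 / y > 0" "1 / y \<le> 1" using assms by auto
  then have "(of_int a :: rat) > of_int b" "(of_int a :: rat) \<le> of_int (b + 1)"
    using assms by auto
  then show b: "b = a - 1" by (simp only: of_int_less_iff of_int_le_iff)
  show "y = 1" using assms b by auto
qed

lemma q_cfrac_cong:
  fixes q :: "'a::field"
  assumes "q \<noteq> 0" "q \<noteq> 1" "\<forall>c\<in>set as. c \<ge> 1" "\<forall>c\<in>set bs. c \<ge> 1" "cfrac a as = cfrac b bs"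
  shows "q_cfrac q a as = q_cfrac q b bs"
  using assms
proof (induction as arbitrary: a b bs q)
  case Nil
  show ?case
  proof (cases bs)
    case Nil
    then show ?thesis using Nil.prems by simp
  next
    case (Cons c cs)
    have y: "cfrac c cs \<ge> 1" "cfrac c cs = 1 \<Longrightarrow> c = 1 \<and> cs = []"
      using cfrac_tail_ge_1[of c cs] Nil.prems Cons by auto
    have "of_int a = of_int b + 1 / cfrac c cs" using Nil.prems Cons by simp
    from int_eq_int_plus_inverse[OF this y(1)] y(2)
    have "b = a - 1" "bs = [1]" using Cons by auto
    then show ?thesis using q_cfrac_integer[of q a] Nil.prems by simp
  qed
next
  case (Cons d ds)
  have x: "cfrac d ds \<ge> 1" "cfrac d ds = 1 \<Longrightarrow> d = 1 \<and> ds = []"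
    using cfrac_tail_ge_1[of d ds] Cons.prems by auto
  show ?case
  proof (cases bs)
    case Nil
    have "of_int b = of_int a + 1 / cfrac d ds" using Cons.prems Nil by simp
    from int_eq_int_plus_inverse[OF this x(1)] x(2)
    have "a = b - 1" "d = 1" "ds = []" by auto
    then show ?thesis using q_cfrac_integer[of q b] Cons.prems Nil by simp
  next
    case (Cons c cs)
    have y: "cfrac c cs \<ge> 1" using cfrac_tail_ge_1[of c cs] Cons.prems Cons by auto
    have eq: "of_int a + 1 / cfrac d ds = of_int b + 1 / cfrac c cs"
      using Cons.prems Cons by simp
    have "1 / cfrac d ds > 0" "1 / cfrac d ds \<le> 1" "1 / cfrac c cs > 0" "1 / cfrac c cs \<le> 1"
      using x(1) y by auto
    then have "(of_int a :: rat) < of_int (b + 1)" "(of_int b :: rat) < of_int (a + 1)"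
      using eq unfolding of_int_add of_int_1 by linarith+
    then have ab: "a = b" by (simp only: of_int_less_iff)
    then have "cfrac d ds = cfrac c cs" using eq by simp
    then have "q_cfrac (1 / q) d ds = q_cfrac (1 / q) c cs"
      using Cons.IH[of "1 / q" cs d c] Cons.prems Cons by auto
    then show ?thesis using ab Cons by simp
  qed
qed

lemma cfrac_exists_aux:
  "n > 0 \<Longrightarrow> \<exists>as. is_cfrac_of (of_int p / of_int (int n)) (p div int n) as"
proof (induction n arbitrary: p rule: less_induct)
  case (less n)
  define r where "r = nat (p mod int n)"
  have r: "int r = p mod int n" "r < n"
    using less.prems by (simp_all add: r_def nat_less_iff)
  have "(p div int n) * int n + int r = p" using r by simp
  then have "(of_int p :: rat) = of_int (p div int n) * of_int (int n) + of_int (int r)"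
    by (metis of_int_add of_int_mult)
  then have x: "(of_int p / of_int (int n) :: rat)
      = of_int (p div int n) + 1 / (of_int (int n) / of_int (int r))"
    using less.prems by (simp add: add_divide_distrib)
  show ?case
  proof (cases "r = 0")
    case True
    then show ?thesis using x by (intro exI[of _ "[]"]) (simp add: is_cfrac_of_def)
  next
    case False
    obtain as where as: "is_cfrac_of (of_int (int n) / of_int (int r)) (int n div int r) as"
      using less.IH[of r "int n"] r False by blast
    have "int n div int r > 0"
      using r(2) False by (subst pos_imp_zdiv_pos_iff) auto
    then have "is_cfrac_of (of_int p / of_int (int n)) (p div int n) ((int n div int r) # as)"
      using as unfolding is_cfrac_of_def x by simp
    then show ?thesis by blast
  qed
qed

lemma cfrac_exists: "\<exists>a as. is_cfrac_of x a as"
proof -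
  obtain p d where pd: "quotient_of x = (p, d)" by fastforce
  have "d > 0" "x = of_int p / of_int d"
    using quotient_of_denom_pos[OF pd] quotient_of_div[OF pd] by auto
  then show ?thesis using cfrac_exists_aux[of "nat d" p] by auto
qed

theorem q_rational_eq:
  assumes "is_cfrac_of x a as"
  shows "q_rational x = q_cfrac q_var a as"
  unfolding q_rational_def
proof (rule the_equality)
  show "\<exists>b bs. is_cfrac_of x b bs \<and> q_cfrac q_var a as = q_cfrac q_var b bs"
    using assms by blast
next
  fix r
  assume "\<exists>b bs. is_cfrac_of x b bs \<and> r = q_cfrac q_var b bs"
  then obtain b bs where "is_cfrac_of x b bs" "r = q_cfrac q_var b bs" by blast
  then show "r = q_cfrac q_var a as"
    using assms q_cfrac_cong[OF q_var_nontrivial, of bs as b a] unfolding is_cfrac_of_def by metis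
qed

end

theory Submission
  imports Defs
begin

text \<open>
  Write \<open>D x = (x\<^sup>2 - x + 1 - f(x)\<^sup>2) / 2\<close>, where \<open>f\<close> is Thomae's function. The proof is an
  induction along the continued fraction: it checks that \<open>D\<close> obeys the recursion that the
  derivative of the \<open>q\<close>-deformation at \<open>q = 1\<close> obeys. For \<open>x = a + 1 / y\<close> with
  \<open>y \<ge> 1\<close>, the deformation satisfies \<open>[x]\<^sub>q = [a]\<^sub>q + q\<^sup>a / [y]\<close> with \<open>[y]\<close> taken at \<open>1 / q\<close>.
  Since \<open>q \<mapsto> 1 / q\<close> has derivative \<open>-1\<close> at \<open>1\<close>, the sign from the reciprocal and the sign from the
  substitution cancel, and differentiating at \<open>1\<close> gives
  \<open>D x = a (a - 1) / 2 + a / y + D y / y\<^sup>2\<close>. After expansion, this identity amounts to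
  \<open>f(a + 1 / y) = f(y) / y\<close>, which holds because \<open>y = p / r\<close> in lowest terms makes
  \<open>(a p + r) / p\<close> the lowest terms of \<open>a + 1 / y\<close> (lemma \<open>thomae_int_plus_inverse\<close>).

  The deformation is an element of the abstract field of rational functions, and its
  recursion substitutes \<open>1 / q\<close> for \<open>q\<close>. Both are handled by computing with
  first-order Taylor data of field elements (\<open>has_jet\<close>): a pair of value and derivative, which
  the field operations transform by the usual rules. The substitution \<open>1 / q\<close> then only means
  that the induction runs over every \<open>q \<noteq> 1\<close> whose value is \<open>1\<close>, with an arbitrary derivative \<open>e\<close>;
  passing to the tail replaces \<open>e\<close> by \<open>-e\<close>. Only at the end are the Taylor data of the
  deformation turned into a statement about evaluation (lemma \<open>has_jet_imp_derivative\<close>).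
\<close>

section \<open>First-order Taylor data of rational functions\<close>

text \<open>
  The last two conditions are \<open>n = r d\<close> and its derivative \<open>n' = r' d + r d'\<close>, evaluated at \<open>c\<close>
  with \<open>v\<close> for \<open>r\<close> and \<open>D\<close> for \<open>r'\<close>. The fraction need not be in lowest terms, so the rules for sums
  and products can use the obvious numerators and denominators without cancelling.
\<close>

definition has_jet :: "real \<Rightarrow> ratfun \<Rightarrow> real \<Rightarrow> real \<Rightarrow> bool" where
  "has_jet c r v D \<longleftrightarrow> (\<exists>n d. r = to_fract n / to_fract d \<and> poly d c \<noteq> 0
     \<and> poly n c = v * poly d c
     \<and> poly (pderiv n) c = D * poly d c + v * poly (pderiv d) c)"

lemma has_jet_poly: "has_jet c (to_fract p) (poly p c) (poly (pderiv p) c)"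
  unfolding has_jet_def by (intro exI[of _ p] exI[of _ 1]) simp

lemma has_jet_one: "has_jet c 1 1 0"
  using has_jet_poly[of c 1] by simp

lemma has_jet_q_var: "has_jet c q_var c 1"
  using has_jet_poly[of c "[:0, 1:]"] by (simp add: q_var_def pderiv_pCons)

lemma has_jet_add:
  assumes "has_jet c r v D" "has_jet c s w E"
  shows "has_jet c (r + s) (v + w) (D + E)"
proof -
  obtain n d where r: "r = to_fract n / to_fract d" "poly d c \<noteq> 0" "poly n c = v * poly d c"
    "poly (pderiv n) c = D * poly d c + v * poly (pderiv d) c"
    using assms(1) unfolding has_jet_def by blast
  obtain m e where s: "s = to_fract m / to_fract e" "poly e c \<noteq> 0" "poly m c = w * poly e c"
    "poly (pderiv m) c = E * poly e c + w * poly (pderiv e) c"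
    using assms(2) unfolding has_jet_def by blast
  have "d \<noteq> 0" "e \<noteq> 0" using r s by auto
  then have "r + s = to_fract (n * e + m * d) / to_fract (d * e)"
    by (simp add: r s add_frac_eq)
  then show ?thesis unfolding has_jet_def using r s
    by (intro exI[of _ "n * e + m * d"] exI[of _ "d * e"])
      (simp add: pderiv_add pderiv_mult algebra_simps)
qed

lemma has_jet_mult:
  assumes "has_jet c r v D" "has_jet c s w E"
  shows "has_jet c (r * s) (v * w) (D * w + v * E)"
proof -
  obtain n d where r: "r = to_fract n / to_fract d" "poly d c \<noteq> 0" "poly n c = v * poly d c"
    "poly (pderiv n) c = D * poly d c + v * poly (pderiv d) c"
    using assms(1) unfolding has_jet_def by blast
  obtain m e where s: "s = to_fract m / to_fract e" "poly e c \<noteq> 0" "poly m c = w * poly e c"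
    "poly (pderiv m) c = E * poly e c + w * poly (pderiv e) c"
    using assms(2) unfolding has_jet_def by blast
  have "r * s = to_fract (n * m) / to_fract (d * e)" by (simp add: r s)
  then show ?thesis unfolding has_jet_def using r s
    by (intro exI[of _ "n * m"] exI[of _ "d * e"])
      (simp add: pderiv_mult algebra_simps)
qed

lemma has_jet_diff:
  assumes "has_jet c r v D" "has_jet c s w E"
  shows "has_jet c (r - s) (v - w) (D - E)"
proof -
  have "has_jet c (to_fract [:-1:]) (-1) 0"
    using has_jet_poly[of c "[:-1:]"] by simp
  moreover have "to_fract [:-1:] = (-1 :: ratfun)"
    by (simp add: to_fract_def One_fract_def one_pCons)
  ultimately have "has_jet c (-1 * s) (-1 * w) (0 * w + -1 * E)"
    using assms(2) has_jet_mult by metis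
  from has_jet_add[OF assms(1) this] show ?thesis by simp
qed

lemma has_jet_inverse:
  assumes "has_jet c r v D" "v \<noteq> 0"
  shows "has_jet c (1 / r) (1 / v) (- D / v\<^sup>2)"
proof -
  obtain n d where r: "r = to_fract n / to_fract d" "poly d c \<noteq> 0" "poly n c = v * poly d c"
    "poly (pderiv n) c = D * poly d c + v * poly (pderiv d) c"
    using assms(1) unfolding has_jet_def by blast
  have "1 / r = to_fract d / to_fract n" by (simp add: r)
  moreover have "poly n c \<noteq> 0" "poly d c = 1 / v * poly n c"
    using r(2,3) assms(2) by simp_all
  moreover have "poly (pderiv d) c = - D / v\<^sup>2 * poly n c + 1 / v * poly (pderiv n) c"
    unfolding r(3,4) using assms(2) by (simp add: power2_eq_square distrib_left)
  ultimately show ?thesis unfolding has_jet_def by blast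
qed

lemma has_jet_divide:
  assumes "has_jet c r v D" "has_jet c s w E" "w \<noteq> 0"
  shows "has_jet c (r / s) (v / w) (D / w - v * E / w\<^sup>2)"
  using has_jet_mult[OF assms(1) has_jet_inverse[OF assms(2,3)]] by simp

lemma has_jet_nonzero:
  assumes "has_jet c r v D" "v \<noteq> 0"
  shows "r \<noteq> 0"
proof -
  obtain n d where "r = to_fract n / to_fract d" "poly d c \<noteq> 0" "poly n c = v * poly d c"
    using assms(1) unfolding has_jet_def by blast
  moreover from this have "n \<noteq> 0" "d \<noteq> 0" using assms(2) by auto
  ultimately show ?thesis by simp
qed

text \<open>
  Evaluation is defined through lowest terms. The lowest-terms denominator divides every
  denominator, in particular \<open>d\<close>, so it does not vanish at \<open>t\<close> either, and any fraction with a
  nonvanishing denominator may be used to evaluate.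
\<close>

lemma ratfun_eval_quotient:
  assumes "poly d t \<noteq> 0"
  shows "ratfun_eval (to_fract n / to_fract d) t = poly n t / poly d t"
proof -
  obtain n' d' where q: "quot_of_fract (to_fract n / to_fract d) = (n', d')" by fastforce
  have d: "d \<noteq> 0" using assms by auto
  have d': "d' \<noteq> 0" using snd_quot_of_fract_nonzero[of "to_fract n / to_fract d"] q by simp
  have "coprime n' d'" using coprime_quot_of_fract[of "to_fract n / to_fract d"] q by simp
  have "to_fract n / to_fract d = to_fract n' / to_fract d'"
    using Fract_quot_of_fract[of "to_fract n / to_fract d"] q by (simp add: Fract_conv_to_fract)
  then have "to_fract (n * d') = to_fract (n' * d)"
    using d d' by (simp add: frac_eq_eq)
  then have eq: "n * d' = n' * d" by (simp only: to_fract_eq_iff)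
  then have "d' dvd n' * d" by (metis dvd_triv_right)
  then have "d' dvd d" using \<open>coprime n' d'\<close>
    by (simp add: coprime_commute coprime_dvd_mult_right_iff)
  then have "poly d' t \<noteq> 0" using assms by (auto elim: dvdE)
  moreover have "poly n t * poly d' t = poly n' t * poly d t"
    using arg_cong[OF eq, of "\<lambda>p. poly p t"] by simp
  ultimately show ?thesis
    using assms by (simp add: ratfun_eval_def q frac_eq_eq)
qed

lemma has_jet_imp_derivative:
  assumes "has_jet c r v D"
  shows "(ratfun_eval r has_real_derivative D) (at c)"
proof -
  obtain n d where r: "r = to_fract n / to_fract d" "poly d c \<noteq> 0" "poly n c = v * poly d c"
    "poly (pderiv n) c = D * poly d c + v * poly (pderiv d) c"
    using assms(1) unfolding has_jet_def by blast
  have "((\<lambda>t. poly n t / poly d t) has_real_derivative D) (at c)"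
  proof (rule DERIV_cong[OF DERIV_divide[OF poly_DERIV poly_DERIV r(2)]])
    have "poly (pderiv n) c * poly d c - poly n c * poly (pderiv d) c
        = D * (poly d c * poly d c)"
      unfolding r(3,4) by (simp add: algebra_simps)
    then show "(poly (pderiv n) c * poly d c - poly n c * poly (pderiv d) c)
        / (poly d c * poly d c) = D"
      using r(2) by simp
  qed
  moreover have "eventually (\<lambda>t. ratfun_eval r t = poly n t / poly d t) (nhds c)"
  proof -
    have "open {t. poly d t \<noteq> 0}" by (intro open_Collect_neq continuous_intros)
    then have "eventually (\<lambda>t. poly d t \<noteq> 0) (nhds c)"
      using r(2) eventually_nhds by blast
    then show ?thesis
      by eventually_elim (simp add: r(1) ratfun_eval_quotient)
  qed
  ultimately show ?thesis by (subst DERIV_cong_ev[OF refl _ refl])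
qed

section \<open>The \<open>q\<close>-integers\<close>

text \<open>
  The quotient \<open>(1 - q\<^sup>n) / (1 - q)\<close> is \<open>0 / 0\<close> at \<open>q = 1\<close>, so its Taylor data cannot be read off.
  They come from \<open>[n + 1]\<^sub>q = 1 + q [n]\<^sub>q\<close>, which determines all \<open>q\<close>-integers from
  \<open>[0]\<^sub>q = 0\<close>, upwards as well as downwards.
\<close>

lemma q_int_plus_one:
  fixes q :: "'a::field"
  assumes "q \<noteq> 0" "q \<noteq> 1"
  shows "q_int q (n + 1) = 1 + q * q_int q n"
  using assms by (simp add: q_int_def power_int_add field_simps)

lemma has_jet_q_int:
  assumes q: "has_jet c q 1 e" "q \<noteq> 1"
  shows "has_jet c (q_int q n) (of_int n) (e * (of_int n * (of_int n - 1) / 2))"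
proof (induction n rule: int_induct[where k = 0])
  case base
  show ?case using has_jet_poly[of c 0] by (simp add: q_int_def)
next
  case (step1 i)
  have "q \<noteq> 0" using has_jet_nonzero[OF q(1)] by simp
  then have "q_int q (i + 1) = 1 + q * q_int q i" using q(2) by (rule q_int_plus_one)
  with has_jet_add[OF has_jet_one has_jet_mult[OF q(1) step1.IH]]
  show ?case by (simp add: field_simps)
next
  case (step2 i)
  have "q \<noteq> 0" using has_jet_nonzero[OF q(1)] by simp
  then have "q_int q (i - 1) = (q_int q i - 1) / q"
    using q_int_plus_one[of q "i - 1"] q(2) by simp
  with has_jet_divide[OF has_jet_diff[OF step2.IH has_jet_one] q(1)]
  show ?case by (simp add: field_simps)
qed

lemma has_jet_q_powi:
  assumes q: "has_jet c q 1 e" "q \<noteq> 1"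
  shows "has_jet c (q powi n) 1 (e * of_int n)"
proof -
  have "q powi n = 1 - (1 - q) * q_int q n" using q(2) by (simp add: q_int_def)
  with has_jet_diff[OF has_jet_one
      has_jet_mult[OF has_jet_diff[OF has_jet_one q(1)] has_jet_q_int[OF q]]]
  show ?thesis by simp
qed

section \<open>Thomae's function\<close>

lemma thomae_lowest_terms:
  assumes "coprime a b" "b > 0"
  shows "thomae (of_int a / of_int b) = 1 / of_int b"
proof -
  have "(THE b'. b' > 0 \<and> (\<exists>a'::int. coprime a' b' \<and>
      (of_int a / of_int b :: real) = of_int a' / of_int b')) = b"
  proof (rule the_equality)
    fix b' :: int
    assume "b' > 0 \<and> (\<exists>a'. coprime a' b' \<and> (of_int a / of_int b :: real) = of_int a' / of_int b')"
    then obtain a' where b': "b' > 0" "coprime a' b'"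
      "(of_int a / of_int b :: real) = of_int a' / of_int b'" by blast
    then have "(of_int (a * b') :: real) = of_int (a' * b)"
      using assms(2) by (simp add: frac_eq_eq)
    then have eq: "a * b' = a' * b" by (simp only: of_int_eq_iff)
    have "b dvd b'" using eq assms(1)
      by (metis coprime_commute coprime_dvd_mult_right_iff dvd_triv_right)
    moreover have "b' dvd b" using eq b'(2)
      by (metis coprime_commute coprime_dvd_mult_right_iff dvd_triv_right)
    ultimately show "b' = b" using b'(1) assms(2) by (simp add: zdvd_antisym_nonneg)
  qed (use assms in blast)
  then show ?thesis by (simp add: thomae_def)
qed

lemma thomae_int_plus_inverse:
  fixes y :: rat
  assumes "y > 0"
  shows "thomae (of_rat (of_int a + 1 / y)) = thomae (of_rat y) / of_rat y"
proof -
  obtain p r where pr: "quotient_of y = (p, r)" by fastforce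
  have r: "r > 0" and cop: "coprime p r" and y: "y = of_int p / of_int r"
    using quotient_of_denom_pos[OF pr] quotient_of_coprime[OF pr] quotient_of_div[OF pr] by auto
  have p: "p > 0" using assms r by (simp add: y zero_less_divide_iff)
  have y': "(of_rat y :: real) = of_int p / of_int r" by (simp add: y of_rat_divide)
  have "coprime (a * p + r) p"
    using cop by (simp add: coprime_iff_gcd_eq_1 gcd.commute gcd_add_mult)
  moreover have "(of_rat (of_int a + 1 / y) :: real) = of_int (a * p + r) / of_int p"
    using p r by (simp add: y of_rat_add of_rat_divide add_divide_distrib)
  ultimately have "thomae (of_rat (of_int a + 1 / y)) = 1 / of_int p"
    using thomae_lowest_terms p by metis
  then show ?thesis using thomae_lowest_terms[OF cop r] p r by (simp add: y')
qed

lemma thomae_int: "thomae (of_int a) = 1"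
  using thomae_lowest_terms[of a 1] by simp

section \<open>Induction along the continued fraction\<close>

definition q_deriv_at_1 :: "rat \<Rightarrow> real" where
  "q_deriv_at_1 x = ((of_rat x)\<^sup>2 - of_rat x + 1 - (thomae (of_rat x))\<^sup>2) / 2"

lemma q_deriv_at_1_int: "q_deriv_at_1 (of_int a) = of_int a * (of_int a - 1) / 2"
  by (simp add: q_deriv_at_1_def thomae_int power2_eq_square algebra_simps)

lemma q_deriv_at_1_int_plus_inverse:
  assumes "y > 0"
  shows "q_deriv_at_1 (of_int a + 1 / y)
    = of_int a * (of_int a - 1) / 2 + of_int a / of_rat y + q_deriv_at_1 y / (of_rat y)\<^sup>2"
proof -
  define z f where "z = (of_rat y :: real)" and "f = thomae z"
  have "z \<noteq> 0" using assms by (simp add: z_def)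
  have "thomae (of_rat (of_int a + 1 / y)) = f / z"
    using thomae_int_plus_inverse[OF assms] by (simp add: z_def f_def)
  moreover have "(of_rat (of_int a + 1 / y) :: real) = of_int a + 1 / z"
    by (simp add: z_def of_rat_add of_rat_divide)
  moreover have "((of_int a + 1 / z)\<^sup>2 - (of_int a + 1 / z) + 1 - (f / z)\<^sup>2) / 2
      = of_int a * (of_int a - 1) / 2 + of_int a / z + (z\<^sup>2 - z + 1 - f\<^sup>2) / 2 / z\<^sup>2"
  proof -
    have "(z\<^sup>2 - z + 1 - f\<^sup>2) / z\<^sup>2 = 1 - 1 / z + (1 / z)\<^sup>2 - (f / z)\<^sup>2"
      using \<open>z \<noteq> 0\<close>
      by (simp add: add_divide_distrib diff_divide_distrib power_divide power2_eq_square)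
    moreover have "(of_int a + 1 / z)\<^sup>2 = (of_int a)\<^sup>2 + 2 * (of_int a / z) + (1 / z)\<^sup>2"
      by (simp add: power2_sum)
    moreover have "of_int a * (of_int a - 1) = (of_int a :: real)\<^sup>2 - of_int a"
      by (simp add: power2_eq_square right_diff_distrib)
    ultimately show ?thesis by argo
  qed
  ultimately show ?thesis
    unfolding q_deriv_at_1_def z_def[symmetric] f_def[symmetric] by simp
qed

lemma has_jet_q_cfrac:
  assumes "has_jet c q 1 e" "q \<noteq> 1" "\<forall>b\<in>set as. b \<ge> 1"
  shows "has_jet c (q_cfrac q a as) (of_rat (cfrac a as)) (e * q_deriv_at_1 (cfrac a as))"
  using assms
proof (induction as arbitrary: q e a)
  case Nil
  then show ?case using has_jet_q_int[of c q e a] by (simp add: q_deriv_at_1_int)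
next
  case (Cons b bs)
  define y where "y = cfrac b bs"
  have "y \<ge> 1" unfolding y_def using cfrac_tail_ge_1(1) Cons.prems(3) by blast
  then have y: "y > 0" by simp
  have "has_jet c (1 / q) 1 (- e)"
    using has_jet_inverse[OF Cons.prems(1)] by simp
  moreover have "1 / q \<noteq> 1" using Cons.prems(2) by (simp add: divide_eq_1_iff)
  ultimately have tail: "has_jet c (q_cfrac (1 / q) b bs) (of_rat y) (- e * q_deriv_at_1 y)"
    unfolding y_def using Cons.prems(3) by (intro Cons.IH) auto
  have "has_jet c (q_cfrac q a (b # bs)) (of_int a + 1 / of_rat y)
    (e * (of_int a * (of_int a - 1) / 2)
      + (e * of_int a / of_rat y - 1 * (- e * q_deriv_at_1 y) / (of_rat y)\<^sup>2))"
    unfolding q_cfrac.simps using y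
    by (intro has_jet_add has_jet_divide has_jet_q_int has_jet_q_powi tail Cons.prems) auto
  moreover have "cfrac a (b # bs) = of_int a + 1 / y" by (simp add: y_def)
  ultimately show ?case
    by (simp add: q_deriv_at_1_int_plus_inverse[OF y] of_rat_add of_rat_divide algebra_simps)
qed

theorem theorem1p1:
  fixes x :: rat
  shows "(ratfun_eval (q_rational x) has_real_derivative
           (1 / 2) * ((of_rat x)\<^sup>2 - of_rat x + 1 - (thomae (of_rat x))\<^sup>2)) (at 1)"
proof -
  obtain a as where x: "is_cfrac_of x a as" using cfrac_exists by blast
  then have "x = cfrac a as" "\<forall>b\<in>set as. b \<ge> 1" by (auto simp: is_cfrac_of_def)
  then have "has_jet 1 (q_rational x) (of_rat x) (1 * q_deriv_at_1 x)"
    unfolding q_rational_eq[OF x]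
    using has_jet_q_cfrac[OF has_jet_q_var q_var_nontrivial(2)] by simp
  from has_jet_imp_derivative[OF this] show ?thesis by (simp add: q_deriv_at_1_def)
qed

end
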